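(* For every integer $n \geq 1$, $$\Gamma\left(\frac{1}{2^n}\right) = \prod_{k=1}^{n} \left(2^{n-1} \cdot \pi_{2^k}\right)^{\frac{1}{2^{\,n-k+1}}}.$$
   Context: $\Gamma$ denotes the Euler Gamma function. For real $s \geq 1$ define $$\pi_s := 2 \int_0^1 \frac{1}{\sqrt{1-x^s}}\, dx$$ (a convergent improper integral). *)

theory Defs
  imports "HOL-Analysis.Analysis"
begin

(* The Henstock-Kurzweil integral over the closed interval agrees with the
   improper Riemann integral, whose singularity is at x = 1; the value of the
   integrand there (1 / 0 = 0) is irrelevant.  Intended for s >= 1. *)
definition pi_gen :: "real \<Rightarrow> real" where
  "pi_gen s = 2 * integral {0..1} (\<lambda>x. 1 / sqrt (1 - x powr s))"

end

theory Submission
  imports Defs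
begin

text \<open>
  Substituting \<open>t = x\<^sup>s\<close> in Euler's Beta integral gives
  \<open>\<pi>\<^sub>s = (2 / s) B(1 / s, 1 / 2)\<close>, which involves the Gamma function at \<open>1 / s\<close> and at
  \<open>1 / s + 1 / 2\<close>.  The product of Gamma at these two arguments is, by Legendre's duplication
  formula, a multiple of Gamma at \<open>2 / s\<close>.  Eliminating \<open>\<Gamma>(1 / s + 1 / 2)\<close> leaves the recursion
  \<open>\<Gamma>(1 / s)\<^sup>2 = s 4\<^sup>-\<^sup>1\<^sup>/\<^sup>s \<pi>\<^sub>s \<Gamma>(2 / s)\<close> (lemma \<open>Gamma_inverse_square\<close>).

  Along \<open>s = 2\<^sup>n\<close> it expresses \<open>\<Gamma>(1 / 2\<^sup>n)\<close> as a square root involving \<open>\<Gamma>(1 / 2\<^sup>n\<^sup>-\<^sup>1)\<close>, and it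
  stops at \<open>\<Gamma>(1) = 1\<close>.  Each unfolding halves all exponents that are already there, which is
  the origin of the exponents \<open>1 / 2\<^sup>n\<^sup>-\<^sup>k\<^sup>+\<^sup>1\<close>.  These add up to \<open>1 - 1 / 2\<^sup>n\<close>, so changing the
  common factor \<open>2\<^sup>n\<^sup>-\<^sup>1\<close> of all bases to \<open>2\<^sup>n\<close> multiplies the product by
  \<open>2 powr (1 - 1 / 2\<^sup>n)\<close>; together with the factor \<open>2\<^sup>n\<close>
  of the new base this is the constant \<open>s 4\<^sup>-\<^sup>1\<^sup>/\<^sup>s\<close> of the recursion for \<open>s = 2\<^sup>n\<^sup>+\<^sup>1\<close>.
\<close>

text \<open>
  The substitution is carried out on the open interval, where \<open>x \<mapsto> x\<^sup>s\<close> is differentiable; the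
  endpoints form a null set.
\<close>

lemma integral_inverse_sqrt_one_minus_powr:
  fixes s :: real
  assumes "s > 0"
  shows "integral {0..1} (\<lambda>x. 1 / sqrt (1 - x powr s)) = Beta (1 / s) (1 / 2) / s"
proof -
  define f where "f = (\<lambda>t::real. t powr (1 / s - 1) * (1 - t) powr (1 / 2 - 1))"
  define g where "g = (\<lambda>x::real. x powr s)"
  define g' where "g' = (\<lambda>x::real. s * x powr (s - 1))"
  have "(f has_integral Beta (1 / s) (1 / 2)) {0..1}"
    unfolding f_def using assms by (intro has_integral_Beta_real) auto
  then have f: "(f has_integral Beta (1 / s) (1 / 2)) {0<..<1}"
    by (simp add: has_integral_Icc_iff_Ioo)
  have "f absolutely_integrable_on {0<..<1}"
    using f by (intro nonnegative_absolutely_integrable_1) (auto simp: f_def integrable_on_def)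
  moreover have image: "g ` {0<..<1} = {0<..<1}"
  proof (intro equalityI subsetI)
    fix y :: real assume y: "y \<in> {0<..<1}"
    show "y \<in> g ` {0<..<1}"
    proof
      show "y = g (y powr (1 / s))" using y assms by (simp add: g_def powr_powr)
      show "y powr (1 / s) \<in> {0<..<1}"
        using y assms powr_less_mono2[of "1 / s" y 1] by simp
    qed
  next
    fix y assume "y \<in> g ` {0<..<1}"
    then show "y \<in> {0<..<1}"
      using assms by (auto simp: g_def intro: powr_less_mono2[where y = 1, simplified])
  qed
  moreover have "(g has_field_derivative g' x) (at x within {0<..<1})" if "x \<in> {0<..<1}" for x
    unfolding g_def g'_def using that by (auto intro!: derivative_eq_intros)
  moreover have "inj_on g {0<..<1}"
    unfolding g_def using assms
    by (intro inj_on_inverseI[where g = "\<lambda>y. y powr (1 / s)"]) (auto simp: powr_powr)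
  ultimately have "integral {0<..<1} (\<lambda>x. \<bar>g' x\<bar> * f (g x)) = Beta (1 / s) (1 / 2)"
    using has_absolute_integral_change_of_variables_1'[of "{0<..<1}" g g' f "Beta (1 / s) (1 / 2)"]
      f by (auto simp: integral_unique)
  moreover have "\<bar>g' x\<bar> * f (g x) = s * (1 / sqrt (1 - x powr s))" if x: "x \<in> {0<..<1}" for x
  proof -
    have "x powr s < 1" using x assms powr_less_mono2[of s x 1] by simp
    moreover have "1 / 2 - 1 = - (1 / 2 :: real)" by simp
    ultimately have "(1 - x powr s) powr (1 / 2 - 1) = 1 / sqrt (1 - x powr s)"
      by (simp only: powr_minus_divide) (simp only: powr_half_sqrt diff_ge_0_iff_ge less_imp_le)
    moreover have "s * (1 / s - 1) = - (s - 1)"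
      using assms by (simp add: right_diff_distrib)
    then have "x powr (s - 1) * (x powr s) powr (1 / s - 1) = 1"
      using x by (simp only: powr_powr powr_minus) simp
    ultimately show ?thesis
      using x assms by (simp add: f_def g_def g'_def abs_mult)
  qed
  ultimately have "integral {0<..<1} (\<lambda>x. s * (1 / sqrt (1 - x powr s))) = Beta (1 / s) (1 / 2)"
    by (metis (no_types, lifting) integral_cong)
  then have "s * integral {0..1} (\<lambda>x. 1 / sqrt (1 - x powr s)) = Beta (1 / s) (1 / 2)"
    by (simp only: integral_mult_right integral_open_interval_real)
  then show ?thesis using assms by (simp add: field_simps)
qed

text \<open>
  The complex formula restricted to the positive axis, which contains no pole of Gamma and on
  which the complex Gamma function takes the values of the real one.
\<close>

lemma Gamma_legendre_duplication_pos_real: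
  fixes x :: real
  assumes "x > 0"
  shows "Gamma x * Gamma (x + 1 / 2) = exp ((1 - 2 * x) * ln 2) * sqrt pi * Gamma (2 * x)"
proof -
  have nonpole: "complex_of_real y \<notin> \<int>\<^sub>\<le>\<^sub>0" if "y > 0" for y
    using that by (auto simp: of_real_in_nonpos_Ints_iff dest: nonpos_Ints_nonpos)
  have "complex_of_real (x + 1 / 2) = of_real x + 1 / 2" by simp
  then have "Gamma (complex_of_real x) * Gamma (complex_of_real (x + 1 / 2)) =
      complex_of_real (exp ((1 - 2 * x) * ln 2) * sqrt pi) * Gamma (complex_of_real (2 * x))"
    using Gamma_legendre_duplication[of "complex_of_real x"] nonpole[of x] nonpole[of "x + 1 / 2"]
      assms by (simp flip: exp_of_real)
  then show ?thesis
    by (simp only: Gamma_complex_of_real of_real_mult[symmetric] of_real_eq_iff)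
qed

text \<open>
  The Beta integral gives \<open>\<Gamma>(1 / s) / \<Gamma>(1 / s + 1 / 2)\<close> in terms of \<open>\<pi>\<^sub>s\<close>, the duplication
  formula gives \<open>\<Gamma>(1 / s) \<Gamma>(1 / s + 1 / 2)\<close>; multiplying the two cancels the shifted argument.
\<close>

lemma Gamma_inverse_square:
  fixes s :: real
  assumes "s > 0"
  shows "Gamma (1 / s) ^ 2 = s * 2 powr (- (2 / s)) * pi_gen s * Gamma (2 / s)"
proof -
  have pos: "Gamma (1 / s + 1 / 2) > 0"
    using assms by (auto intro!: Gamma_real_pos add_pos_pos)
  have "pi_gen s = 2 / s * (Gamma (1 / s) * sqrt pi / Gamma (1 / s + 1 / 2))"
    unfolding pi_gen_def using assms
    by (simp add: integral_inverse_sqrt_one_minus_powr Beta_def Gamma_one_half_real)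
  then have 1: "s * pi_gen s * Gamma (1 / s + 1 / 2) = 2 * sqrt pi * Gamma (1 / s)"
    using assms pos by (simp del: Gamma_eq_zero_iff)
  have "2 * (1 / s) = 2 / s" by simp
  then have "Gamma (1 / s) * Gamma (1 / s + 1 / 2)
      = exp ((1 - 2 / s) * ln 2) * sqrt pi * Gamma (2 / s)"
    using Gamma_legendre_duplication_pos_real[of "1 / s"] assms by simp
  also have "exp ((1 - 2 / s) * ln 2) = 2 * 2 powr (- (2 / s))"
    by (simp add: powr_def exp_add[symmetric] exp_diff exp_minus algebra_simps divide_inverse)
  finally have 2: "Gamma (1 / s) * Gamma (1 / s + 1 / 2)
      = 2 * 2 powr (- (2 / s)) * sqrt pi * Gamma (2 / s)" .
  have "Gamma (1 / s) ^ 2 * (2 * sqrt pi * Gamma (1 / s + 1 / 2))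
      = (s * 2 powr (- (2 / s)) * pi_gen s * Gamma (2 / s)) * (2 * sqrt pi * Gamma (1 / s + 1 / 2))"
    using 1 2 by algebra
  then show ?thesis using pos by (simp del: Gamma_eq_zero_iff)
qed

lemma pi_gen_pos:
  assumes "s > 0"
  shows "pi_gen s > 0"
  unfolding pi_gen_def integral_inverse_sqrt_one_minus_powr[OF assms] Beta_def
  using assms by (auto intro!: mult_pos_pos divide_pos_pos Gamma_real_pos add_pos_pos)

lemma sum_halving_exponents:
  "(\<Sum>k = 1..n. 1 / 2 ^ (n - k + 1) :: real) = 1 - 1 / 2 ^ n"
proof (induction n)
  case (Suc n)
  have "(\<Sum>k = 1..n. 1 / 2 ^ (Suc n - k + 1) :: real) = (\<Sum>k = 1..n. 1 / 2 ^ (n - k + 1)) / 2"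
    unfolding sum_divide_distrib by (intro sum.cong refl) (simp add: Suc_diff_le)
  then show ?case using Suc by simp
qed simp

theorem corollary6:
  fixes n :: nat
  assumes "n \<ge> 1"
  shows "Gamma (1 / 2 ^ n :: real) =
    (\<Prod>k = 1..n. (2 ^ (n - 1) * pi_gen (2 ^ k)) powr (1 / 2 ^ (n - k + 1)))"
  using assms
proof (induction n rule: nat_induct_at_least)
  case base
  have "Gamma (1 / 2) ^ 2 = pi_gen 2"
    using Gamma_inverse_square[of 2] by (simp add: powr_minus)
  then show ?case
    using pi_gen_pos[of 2] by (simp add: powr_half_sqrt real_sqrt_unique)
next
  case (Suc n)
  let ?P = "\<lambda>n. \<Prod>k = 1..n. (2 ^ (n - 1) * pi_gen (2 ^ k)) powr (1 / 2 ^ (n - k + 1))"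
  have pos: "pi_gen (2 ^ k) > 0" for k by (simp add: pi_gen_pos)
  \<comment> \<open>Squaring turns the exponent of the last factor into 1 and those of the others into the
     exponents for \<open>n\<close>, so the recursion can be compared with the squares of both sides.\<close>
  have "?P (Suc n) ^ 2 =
      (\<Prod>k = 1..Suc n. (2 ^ n * pi_gen (2 ^ k)) powr (1 / 2 ^ (Suc n - k)))"
    unfolding prod_power_distrib
    by (intro prod.cong refl) (simp add: power2_eq_square flip: powr_add)
  also have "\<dots> = 2 ^ n * pi_gen (2 ^ Suc n)
      * (\<Prod>k = 1..n. (2 ^ n * pi_gen (2 ^ k)) powr (1 / 2 ^ (Suc n - k)))"
    using pos[of "Suc n"] by simp
  also have "(\<Prod>k = 1..n. (2 ^ n * pi_gen (2 ^ k)) powr (1 / 2 ^ (Suc n - k)))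
      = (\<Prod>k = 1..n. 2 powr (1 / 2 ^ (n - k + 1))
          * (2 ^ (n - 1) * pi_gen (2 ^ k)) powr (1 / 2 ^ (n - k + 1)))"
  proof (intro prod.cong refl)
    fix k assume k: "k \<in> {1..n}"
    have "(2::real) ^ n = 2 * 2 ^ (n - 1)" using Suc.hyps by (cases n) auto
    then have "(2 ^ n * pi_gen (2 ^ k)) powr e = 2 powr e * (2 ^ (n - 1) * pi_gen (2 ^ k)) powr e"
      for e using pos[of k] by (simp add: powr_mult mult.assoc)
    moreover have "Suc n - k = n - k + 1" using k by auto
    ultimately show "(2 ^ n * pi_gen (2 ^ k)) powr (1 / 2 ^ (Suc n - k))
        = 2 powr (1 / 2 ^ (n - k + 1)) * (2 ^ (n - 1) * pi_gen (2 ^ k)) powr (1 / 2 ^ (n - k + 1))" by simp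
  qed
  also have "\<dots> = 2 powr (1 - 1 / 2 ^ n) * Gamma (1 / 2 ^ n)"
    unfolding prod.distrib Suc.IH sum_halving_exponents[symmetric] by (simp add: powr_sum)
  also have "2 ^ n * pi_gen (2 ^ Suc n) * (2 powr (1 - 1 / 2 ^ n) * Gamma (1 / 2 ^ n))
      = Gamma (1 / 2 ^ Suc n) ^ 2"
  proof -
    have halve: "2 / 2 ^ Suc n = 1 / (2::real) ^ n" by simp
    have "2 powr (1 - 1 / 2 ^ n) = 2 * (2::real) powr (- (1 / 2 ^ n))"
      using powr_add[of "2::real" 1 "- (1 / 2 ^ n)"] by simp
    moreover have "Gamma (1 / 2 ^ Suc n) ^ 2
        = 2 * 2 ^ n * 2 powr (- (1 / 2 ^ n)) * pi_gen (2 ^ Suc n) * Gamma (1 / 2 ^ n)"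
      unfolding halve[symmetric] power_Suc[symmetric]
      by (rule Gamma_inverse_square) (rule zero_less_power, rule zero_less_numeral)
    ultimately show ?thesis by (simp only: mult_ac)
  qed
  finally have "?P (Suc n) ^ 2 = Gamma (1 / 2 ^ Suc n) ^ 2" .
  moreover have "?P (Suc n) \<ge> 0" by (intro prod_nonneg) auto
  moreover have "Gamma (1 / 2 ^ Suc n :: real) \<ge> 0" by (intro less_imp_le Gamma_real_pos) auto
  ultimately show ?case by (rule power2_eq_imp_eq[symmetric])
qed

end
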